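(* Let $n\ge 2$ be an integer and let $x_1,\dots,x_n$ be positive real numbers, not all equal. Let $\overline{x}=\frac1n\sum_{i=1}^n x_i$ and $m_r=\frac1n\sum_{i=1}^n (x_i-\overline{x})^r$ for $r=2,4$, and put $\alpha_4=\frac{m_4}{m_2^2}$ and $V=\frac{\sqrt{m_2}}{\overline{x}}$. Then $$\frac{\alpha_4}{V^4}\ge \frac{n^2-3n+3}{(n-1)^3}.$$
   Context: $m_r$ is the $r$-th central moment of $x_1,\dots,x_n$; $\alpha_4$ is the kurtosis and $V$ is the Karl Pearson coefficient of dispersion. *)

theory Defs
  imports Complex_Main
begin

text \<open>The data \<open>x\<^sub>1, \<dots>, x\<^sub>n\<close> are the values \<open>x 1, \<dots>, x n\<close> of a function on \<open>nat\<close>;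
  values outside \<open>{1..n}\<close> are never used.\<close>

definition arith_mean :: "nat \<Rightarrow> (nat \<Rightarrow> real) \<Rightarrow> real" where
  "arith_mean n x = (1 / real n) * (\<Sum>i=1..n. x i)"

definition central_moment :: "nat \<Rightarrow> nat \<Rightarrow> (nat \<Rightarrow> real) \<Rightarrow> real" where
  "central_moment r n x = (1 / real n) * (\<Sum>i=1..n. (x i - arith_mean n x) ^ r)"

definition kurtosis :: "nat \<Rightarrow> (nat \<Rightarrow> real) \<Rightarrow> real" where
  "kurtosis n x = central_moment 4 n x / (central_moment 2 n x) ^ 2"

text \<open>Karl Pearson's coefficient of dispersion \<open>V\<close>.\<close>

definition pearson_dispersion :: "nat \<Rightarrow> (nat \<Rightarrow> real) \<Rightarrow> real" where
  "pearson_dispersion n x = sqrt (central_moment 2 n x) / arith_mean n x"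

end

theory Submission
  imports Defs
begin

text \<open>Scale the data to mean 1, write \<open>x = 1 + d\<close> and let \<open>s, M\<^sub>3, M\<^sub>4\<close> be the moments of
  the deviations \<open>d\<close>; the claim becomes \<open>M\<^sub>4 \<ge> c s\<^sup>4\<close>.
  Averaging \<open>(1 + d) (d - s)\<^sup>2 \<ge> 0\<close> gives \<open>M\<^sub>3 \<ge> s (s - 1)\<close>.
  Averaging \<open>(d\<^sup>2 - a d - s)\<^sup>2 \<ge> 0\<close> gives \<open>M\<^sub>4 \<ge> s\<^sup>2 + 2 a M\<^sub>3 - a\<^sup>2 s\<close>; take \<open>a = 0\<close> if \<open>s \<le> 1\<close>,
  and \<open>a = s - 1\<close> otherwise, so that \<open>M\<^sub>4 \<ge> s (s\<^sup>2 - s + 1)\<close>.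
  Finally \<open>s \<le> n - 1\<close> because the data are nonnegative, and \<open>(s\<^sup>2 - s + 1) / s\<^sup>3\<close> is decreasing,
  with value \<open>c\<close> at \<open>s = n - 1\<close>.\<close>

lemma quotient_antimono:
  fixes s t :: real
  assumes "0 < s" "s \<le> t"
  shows "(t\<^sup>2 - t + 1) / t ^ 3 \<le> (s\<^sup>2 - s + 1) / s ^ 3"
proof -
  \<comment> \<open>Completing the square in \<open>s * t\<close> shows that the cofactor of
    \<open>t - s\<close>, namely s^2 t^2 - s t (s + t) + s^2 + s t + t^2, is nonnegative.\<close>
  have "(s\<^sup>2 - s + 1) * t ^ 3 - (t\<^sup>2 - t + 1) * s ^ 3
      = (t - s) * ((s * t - (s + t) / 2)\<^sup>2 + (3 * s\<^sup>2 + 2 * s * t + 3 * t\<^sup>2) / 4)"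
    by (simp add: field_simps power2_eq_square power3_eq_cube)
  also have "\<dots> \<ge> 0"
    using assms by (intro mult_nonneg_nonneg add_nonneg_nonneg) auto
  finally show ?thesis
    using assms by (simp add: divide_simps)
qed

text \<open>Scale-free core: the \<open>1 + d i\<close> are nonnegative data of mean 1, for which
  \<open>s\<close> is V^2.\<close>

lemma fourth_moment_ge:
  fixes d :: "'a \<Rightarrow> real" and A :: "'a set"
  defines "N \<equiv> real (card A)"
  assumes "finite A" and ge: "\<And>i. i \<in> A \<Longrightarrow> d i \<ge> - 1" and sum0: "(\<Sum>i\<in>A. d i) = 0"
    and s: "(\<Sum>i\<in>A. (d i)\<^sup>2) = N * s" and "card A \<ge> 2" and "s > 0"
  shows "(\<Sum>i\<in>A. d i ^ 4) \<ge> N * ((N\<^sup>2 - 3 * N + 3) / (N - 1) ^ 3 * s ^ 4)"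
proof -
  \<comment> \<open>\<open>s\<close> is a mean, while \<open>M3\<close> and \<open>M4\<close> are
    plain sums; hence the factors \<open>N\<close> below.\<close>
  define M3 where "M3 = (\<Sum>i\<in>A. d i ^ 3)"
  define M4 where "M4 = (\<Sum>i\<in>A. d i ^ 4)"
  define c where "c = (N\<^sup>2 - 3 * N + 3) / (N - 1) ^ 3"
  have N: "N \<ge> 2"
    using assms by simp
  have "s \<le> N - 1"
  proof -
    \<comment> \<open>The nonnegative \<open>1 + d i\<close> sum to \<open>N\<close>, so none
      exceeds \<open>N\<close>; bounding one factor of each square then gives
      \<open>N + N * s \<le> N * N\<close>.\<close>
    have "1 + d i \<le> N" if "i \<in> A" for i
    proof -
      have "1 + d i \<le> (\<Sum>i\<in>A. 1 + d i)"
        using that ge \<open>finite A\<close> by (intro member_le_sum) (force simp: algebra_simps)+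
      then show ?thesis
        by (simp add: sum.distrib sum0 N_def)
    qed
    then have "(\<Sum>i\<in>A. (1 + d i) * (1 + d i)) \<le> (\<Sum>i\<in>A. (1 + d i) * N)"
      using ge by (intro sum_mono mult_left_mono) (force simp: algebra_simps)+
    also have "\<dots> = N * N"
      by (simp add: sum_distrib_right[symmetric] sum.distrib sum0 N_def)
    also have "(\<Sum>i\<in>A. (1 + d i) * (1 + d i)) = (\<Sum>i\<in>A. 1 + 2 * d i + (d i)\<^sup>2)"
      by (intro sum.cong) (auto simp: algebra_simps power2_eq_square)
    also have "\<dots> = N + N * s"
      by (simp add: sum.distrib sum_distrib_left[symmetric] sum0 s N_def)
    finally have "N * (1 + s) \<le> N * N"
      by (simp add: algebra_simps)
    then show ?thesis
      using N by simp
  qed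
  have M3: "M3 \<ge> N * (s * (s - 1))"
  proof -
    \<comment> \<open>The root \<open>s\<close> is optimal: a root u bounds the mean of
      \<open>d i ^ 3\<close> below by 2 u s - s - u^2, which is largest at u = s.\<close>
    have "0 \<le> (\<Sum>i\<in>A. (1 + d i) * (d i - s)\<^sup>2)"
      using ge by (intro sum_nonneg mult_nonneg_nonneg) (force simp: algebra_simps)+
    also have "\<dots> = (\<Sum>i\<in>A. d i ^ 3 + (1 - 2 * s) * (d i)\<^sup>2 + (s\<^sup>2 - 2 * s) * d i + s\<^sup>2)"
      by (intro sum.cong) (auto simp: algebra_simps power2_eq_square power3_eq_cube)
    also have "\<dots> = M3 + (1 - 2 * s) * (N * s) + N * s\<^sup>2"
      by (simp add: sum.distrib sum_distrib_left[symmetric] sum0 s N_def M3_def)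
    finally show ?thesis
      by (simp add: algebra_simps power2_eq_square)
  qed
  \<comment> \<open>The best \<open>a\<close> is \<open>M3 / (N * s)\<close>; the lower bound on
    \<open>M3\<close> makes this at least \<open>s - 1\<close>, which suggests the choice of
    \<open>a\<close> for \<open>s > 1\<close>.\<close>
  have M4: "M4 \<ge> N * s\<^sup>2 + 2 * a * M3 - a\<^sup>2 * (N * s)" for a
  proof -
    have "0 \<le> (\<Sum>i\<in>A. ((d i)\<^sup>2 - a * d i - s)\<^sup>2)"
      by (intro sum_nonneg) simp
    also have "\<dots> = (\<Sum>i\<in>A. d i ^ 4 + (- 2 * a) * d i ^ 3 + (a\<^sup>2 - 2 * s) * (d i)\<^sup>2
        + (2 * a * s) * d i + s\<^sup>2)"
      by (intro sum.cong)
        (auto simp: algebra_simps power2_eq_square power3_eq_cube power4_eq_xxxx)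
    also have "\<dots> = M4 + (- 2 * a) * M3 + (a\<^sup>2 - 2 * s) * (N * s) + N * s\<^sup>2"
      by (simp add: sum.distrib sum_subtractf sum_distrib_left[symmetric] sum0 s N_def
          M3_def M4_def)
    finally show ?thesis
      by (simp add: algebra_simps power2_eq_square)
  qed
  have c: "c = ((N - 1)\<^sup>2 - (N - 1) + 1) / (N - 1) ^ 3"
    by (simp add: c_def power2_eq_square algebra_simps)
  have "N * (c * s ^ 4) \<le> M4"
  proof (cases "s \<le> 1")
    case True
    \<comment> \<open>The quotient equals 1 at 1, and \<open>N - 1 \<ge> 1\<close>.\<close>
    have "c \<le> 1"
      using quotient_antimono[of 1 "N - 1"] N by (simp add: c)
    then have "c * s ^ 4 \<le> 1 * s ^ 4"
      by (intro mult_right_mono) auto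
    also have "1 * s ^ 4 \<le> s\<^sup>2"
      using True \<open>s > 0\<close> by (simp add: power_decreasing)
    finally have "N * (c * s ^ 4) \<le> N * s\<^sup>2"
      using N by (intro mult_left_mono) auto
    also have "\<dots> \<le> M4"
      using M4[of 0] by simp
    finally show ?thesis .
  next
    case False
    have "c \<le> (s\<^sup>2 - s + 1) / s ^ 3"
      unfolding c using \<open>s > 0\<close> \<open>s \<le> N - 1\<close> by (rule quotient_antimono)
    then have "c * s ^ 4 \<le> (s\<^sup>2 - s + 1) / s ^ 3 * s ^ 4"
      using \<open>s > 0\<close> by (intro mult_right_mono) auto
    also have "\<dots> = s * (s\<^sup>2 - s + 1)"
      using \<open>s > 0\<close> by (simp add: power3_eq_cube power4_eq_xxxx)
    finally have "N * (c * s ^ 4) \<le> N * (s * (s\<^sup>2 - s + 1))"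
      using N by (intro mult_left_mono) auto
    also have "\<dots> = N * s\<^sup>2 + 2 * (s - 1) * (N * (s * (s - 1))) - (s - 1)\<^sup>2 * (N * s)"
      by (simp add: algebra_simps power2_eq_square)
    \<comment> \<open>The coefficient of \<open>M3\<close> is nonnegative only because
      \<open>s > 1\<close> here.\<close>
    also have "\<dots> \<le> N * s\<^sup>2 + 2 * (s - 1) * M3 - (s - 1)\<^sup>2 * (N * s)"
      using M3 False by (intro diff_right_mono add_left_mono mult_left_mono) auto
    also have "\<dots> \<le> M4"
      by (rule M4)
    finally show ?thesis .
  qed
  then show ?thesis
    by (simp add: c_def M4_def)
qed

theorem corollary2p10:
  fixes n :: nat and x :: "nat \<Rightarrow> real"
  assumes "n \<ge> 2"
    and "\<And>i. i \<in> {1..n} \<Longrightarrow> x i > 0"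
    and "\<exists>i\<in>{1..n}. \<exists>j\<in>{1..n}. x i \<noteq> x j"
  shows "kurtosis n x / (pearson_dispersion n x) ^ 4
           \<ge> ((real n) ^ 2 - 3 * real n + 3) / (real n - 1) ^ 3"
proof -
  define m where "m = arith_mean n x"
  define d where "d i = (x i - m) / m" for i
  define s where "s = central_moment 2 n x / m\<^sup>2"
  have n: "real n > 0"
    using assms(1) by simp
  have "(\<Sum>i=1..n. x i) > 0"
    using assms(1,2) by (intro sum_pos) auto
  then have m: "m > 0"
    using n by (simp add: m_def arith_mean_def)
  have sum_d: "(\<Sum>i=1..n. d i ^ r) = real n * (central_moment r n x / m ^ r)" for r
    using n by (simp add: d_def central_moment_def m_def[symmetric] power_divide
        flip: sum_divide_distrib)
  have "(\<Sum>i=1..n. x i) = real n * m"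
    using n by (simp add: m_def arith_mean_def)
  then have sum0: "(\<Sum>i=1..n. d i) = 0"
    by (simp add: d_def sum_subtractf flip: sum_divide_distrib)
  \<comment> \<open>If every value were \<open>m\<close>, no two could differ.\<close>
  obtain k where "k \<in> {1..n}" "x k \<noteq> m"
    using assms(3) by metis
  then have "(\<Sum>i=1..n. (x i - m)\<^sup>2) > 0"
    by (intro sum_pos2[of _ k]) auto
  then have pos: "central_moment 2 n x > 0"
    using n by (simp add: central_moment_def m_def)
  then have "s > 0"
    using m by (simp add: s_def)
  have "d i \<ge> - 1" if "i \<in> {1..n}" for i
    using assms(2)[OF that] m by (simp add: d_def field_simps)
  then have "(\<Sum>i=1..n. d i ^ 4)
      \<ge> real n * (((real n)\<^sup>2 - 3 * real n + 3) / (real n - 1) ^ 3 * s ^ 4)"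
    using fourth_moment_ge[of "{1..n}" d s] sum0 sum_d[of 2] assms(1) \<open>s > 0\<close>
    by (simp add: s_def)
  then have "((real n)\<^sup>2 - 3 * real n + 3) / (real n - 1) ^ 3 * s ^ 4
      \<le> central_moment 4 n x / m ^ 4"
    using n unfolding sum_d by (rule mult_left_le_imp_le)
  then have "((real n)\<^sup>2 - 3 * real n + 3) / (real n - 1) ^ 3
      \<le> central_moment 4 n x / m ^ 4 / s ^ 4"
    using \<open>s > 0\<close> by (subst pos_le_divide_eq) auto
  \<comment> \<open>With \<open>s\<close> = V^2, both sides equal m_4 m^4 / m_2^4.\<close>
  also have "\<dots> = kurtosis n x / (pearson_dispersion n x) ^ 4"
  proof -
    have "sqrt (central_moment 2 n x) ^ 4 = (central_moment 2 n x)\<^sup>2"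
      using pos power_mult[of "sqrt (central_moment 2 n x)" 2 2] by simp
    then show ?thesis
      using pos m
      by (simp add: kurtosis_def pearson_dispersion_def s_def m_def[symmetric]
          power_divide field_simps flip: power_mult power_add)
  qed
  finally show ?thesis .
qed

end
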